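(* Let $E$ be an arbitrary directed graph. (1) The graph $E$ has a cycle with no exit if and only if some nonzero element of $F_E^\Gamma$ is periodic. (2) The graph $E$ has a cycle with an exit if and only if some element of $F_E^\Gamma$ is aperiodic. (3) The graph $E$ is acyclic if and only if every nonzero element of $F_E^\Gamma$ is incomparable.
   Context: Setup. $\Gamma=\{x^n\mid n\in\mathbb Z\}$ is the infinite cyclic group generated by $x$. $E$ is an arbitrary directed graph (not necessarily row-finite) with vertex set $E^0$, edge set $E^1$, source map $\mathbf s$ and range map $\mathbf r$. A vertex $v$ is regular if $\mathbf s^{-1}(v)$ is finite and nonempty, and an infinite emitter if $\mathbf s^{-1}(v)$ is infinite. For every infinite emitter $v$ and every finite nonempty $Z\subseteq \mathbf s^{-1}(v)$ introduce a symbol $q_Z=q_Z^v$, called an improper vertex; elements of $E^0$ are called proper vertices. $F_E^\Gamma$ is the free commutative $\Gamma$-monoid on all proper and improper vertices (these are called the generators): its elements are finite formal sums of monomials $x^m g$ ($m\in\mathbb Z$, $g$ a generator), and $x^n$ acts by $x^n(x^m g)=x^{n+m}g$. The relation $\to_1$ on $F_E^\Gamma-\{0\}$ is given, for all $a\in F_E^\Gamma$ and $m\in\mathbb Z$, by: (A1) $a+x^m v\to_1 a+\sum_{e\in \mathbf s^{-1}(v)}x^{m+1}\mathbf r(e)$ for $v$ regular; (A2) $a+x^m v\to_1 a+x^m q_Z+\sum_{e\in Z}x^{m+1}\mathbf r(e)$ for $v$ an infinite emitter and $Z\subseteq \mathbf s^{-1}(v)$ finite and nonempty; (A3) $a+x^m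 q_Z\to_1 a+x^m q_W+\sum_{e\in W-Z}x^{m+1}\mathbf r(e)$ for $v$ an infinite emitter and finite nonempty $Z\subsetneq W\subseteq \mathbf s^{-1}(v)$. $\sim$ is the congruence on $F_E^\Gamma$ generated by $\to_1$. For $a,b\in F_E^\Gamma$, $a\precsim b$ means that $a+c\sim b$ for some $c\in F_E^\Gamma$; $b\succ a$ means $a\precsim b$ and not $a\sim b$. An element $a$ is periodic if $a\sim x^n a$ for some positive integer $n$; aperiodic if $a\succ x^n a$ for some positive integer $n$; incomparable if for every positive integer $n$ neither $a\precsim x^n a$ nor $x^n a\precsim a$ holds. A cycle is a closed path $e_1\cdots e_n$, $n\geq 1$, with $\mathbf s(e_i)\neq \mathbf s(e_j)$ for $i\ne j$. A cycle has an exit if some vertex on it emits an edge which is not on the cycle. $E$ is acyclic if it has no cycles. *)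

theory Defs
  imports "Graph_Theory.Graph_Theory" "HOL-Library.Multiset"
begin

text \<open>
  A directed graph is a \<open>wf_digraph\<close>: arbitrary vertex and edge sets, loops and multiple edges
  allowed. The source and range maps are \<open>tail\<close> and \<open>head\<close>, and the set of edges with source
  \<open>v\<close> is \<open>out_arcs G v\<close>.
\<close>

text \<open>
  The library notion \<open>cycle\<close> asks for the ranges of the edges of a nonempty closed path to be
  distinct. Since the path is closed, this is the same as distinctness of the sources.
\<close>

lemma cas_mset_heads_tails:
  "pre_digraph.cas G u p v \<Longrightarrow>
    add_mset v (mset (map (tail G) p)) = add_mset u (mset (map (head G) p))"
proof (induction p arbitrary: u)
  case Nil
  then show ?case by (simp add: pre_digraph.cas.simps)
next
  case (Cons e p)
  then have t: "tail G e = u" and "pre_digraph.cas G (head G e) p v"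
    by (simp_all add: pre_digraph.cas.simps)
  with Cons.IH have "add_mset v (mset (map (tail G) p)) = add_mset (head G e) (mset (map (head G) p))"
    by blast
  then show ?case using t by (simp add: add_mset_commute)
qed

lemma cycle_iff_distinct_sources:
  "pre_digraph.cycle G p \<longleftrightarrow>
    p \<noteq> [] \<and> (\<exists>u. pre_digraph.awalk G u p u) \<and> distinct (map (tail G) p)"
proof -
  have "distinct (tl (pre_digraph.awalk_verts G u p)) \<longleftrightarrow> distinct (map (tail G) p)"
    if w: "pre_digraph.awalk G u p u" and "p \<noteq> []" for u
  proof -
    have c: "pre_digraph.cas G u p u" using w by (simp add: pre_digraph.awalk_def)
    then have "mset (map (head G) p) = mset (map (tail G) p)"
      using cas_mset_heads_tails[OF c] by simp
    moreover have "tl (pre_digraph.awalk_verts G u p) = map (head G) p"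
      using pre_digraph.awalk_verts_conv'[OF c] \<open>p \<noteq> []\<close> by simp
    ultimately show ?thesis by (metis mset_eq_imp_distinct_iff)
  qed
  then show ?thesis by (auto simp: pre_digraph.cycle_def)
qed

definition has_exit :: "('a, 'b) pre_digraph \<Rightarrow> 'b list \<Rightarrow> bool" where
  "has_exit G p \<longleftrightarrow> (\<exists>e \<in> arcs G. tail G e \<in> tail G ` set p \<and> e \<notin> set p)"

definition acyclic_digraph :: "('a, 'b) pre_digraph \<Rightarrow> bool" where
  "acyclic_digraph G \<longleftrightarrow> \<not> (\<exists>p. pre_digraph.cycle G p)"

definition regular :: "('a, 'b) pre_digraph \<Rightarrow> 'a \<Rightarrow> bool" where
  "regular G v \<longleftrightarrow> v \<in> verts G \<and> finite (out_arcs G v) \<and> out_arcs G v \<noteq> {}"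

definition infinite_emitter :: "('a, 'b) pre_digraph \<Rightarrow> 'a \<Rightarrow> bool" where
  "infinite_emitter G v \<longleftrightarrow> v \<in> verts G \<and> infinite (out_arcs G v)"

text \<open>\<open>Improper v Z\<close> is the symbol \<open>q\<^sub>Z\<^sup>v\<close>.\<close>

datatype ('a, 'b) generator = Proper 'a | Improper 'a "'b set"

definition generators :: "('a, 'b) pre_digraph \<Rightarrow> ('a, 'b) generator set" where
  "generators G = Proper ` verts G \<union>
    {Improper v Z | v Z. infinite_emitter G v \<and> finite Z \<and> Z \<noteq> {} \<and> Z \<subseteq> out_arcs G v}"

text \<open>
  The infinite cyclic group \<open>\<Gamma>\<close> is written additively as \<open>int\<close>, and the monomial \<open>x\<^sup>m g\<close> is the
  pair \<open>(m, g)\<close>. The free commutative \<open>\<Gamma>\<close>-monoid on the generators is the monoid of finite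
  multisets of monomials, with \<open>x\<^sup>n\<close> acting by \<open>act n\<close>.
\<close>

type_synonym ('a, 'b) gmonoid = "(int \<times> ('a, 'b) generator) multiset"

definition free_monoid :: "('a, 'b) pre_digraph \<Rightarrow> ('a, 'b) gmonoid set" where
  "free_monoid G = {a. set_mset a \<subseteq> UNIV \<times> generators G}"

definition act :: "int \<Rightarrow> ('a, 'b) gmonoid \<Rightarrow> ('a, 'b) gmonoid" where
  "act n a = image_mset (\<lambda>(m, g). (n + m, g)) a"

inductive step :: "('a, 'b) pre_digraph \<Rightarrow> ('a, 'b) gmonoid \<Rightarrow> ('a, 'b) gmonoid \<Rightarrow> bool"
  for G where
  A1: "a \<in> free_monoid G \<Longrightarrow> regular G v \<Longrightarrow>
    step G (a + {#(m, Proper v)#})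
           (a + (\<Sum>e\<in>out_arcs G v. {#(m + 1, Proper (head G e))#}))"
| A2: "a \<in> free_monoid G \<Longrightarrow> infinite_emitter G v \<Longrightarrow>
    finite Z \<Longrightarrow> Z \<noteq> {} \<Longrightarrow> Z \<subseteq> out_arcs G v \<Longrightarrow>
    step G (a + {#(m, Proper v)#})
           (a + {#(m, Improper v Z)#} + (\<Sum>e\<in>Z. {#(m + 1, Proper (head G e))#}))"
| A3: "a \<in> free_monoid G \<Longrightarrow> infinite_emitter G v \<Longrightarrow>
    finite Z \<Longrightarrow> Z \<noteq> {} \<Longrightarrow> Z \<subset> W \<Longrightarrow> finite W \<Longrightarrow> W \<subseteq> out_arcs G v \<Longrightarrow>
    step G (a + {#(m, Improper v Z)#})
           (a + {#(m, Improper v W)#} + (\<Sum>e\<in>W - Z. {#(m + 1, Proper (head G e))#}))"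

text \<open>The \<open>\<Gamma>\<close>-monoid congruence on \<open>free_monoid G\<close> generated by \<open>step G\<close>.\<close>

inductive sim :: "('a, 'b) pre_digraph \<Rightarrow> ('a, 'b) gmonoid \<Rightarrow> ('a, 'b) gmonoid \<Rightarrow> bool"
  for G where
  base: "step G a b \<Longrightarrow> sim G a b"
| refl: "a \<in> free_monoid G \<Longrightarrow> sim G a a"
| sym: "sim G a b \<Longrightarrow> sim G b a"
| trans: "sim G a b \<Longrightarrow> sim G b c \<Longrightarrow> sim G a c"
| add: "sim G a b \<Longrightarrow> c \<in> free_monoid G \<Longrightarrow> sim G (a + c) (b + c)"
| act: "sim G a b \<Longrightarrow> sim G (act n a) (act n b)"

definition precsim :: "('a, 'b) pre_digraph \<Rightarrow> ('a, 'b) gmonoid \<Rightarrow> ('a, 'b) gmonoid \<Rightarrow> bool" where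
  "precsim G a b \<longleftrightarrow> (\<exists>c \<in> free_monoid G. sim G (a + c) b)"

definition succ :: "('a, 'b) pre_digraph \<Rightarrow> ('a, 'b) gmonoid \<Rightarrow> ('a, 'b) gmonoid \<Rightarrow> bool" where
  "succ G b a \<longleftrightarrow> precsim G a b \<and> \<not> sim G a b"

definition periodic :: "('a, 'b) pre_digraph \<Rightarrow> ('a, 'b) gmonoid \<Rightarrow> bool" where
  "periodic G a \<longleftrightarrow> (\<exists>n > 0. sim G a (act n a))"

definition aperiodic :: "('a, 'b) pre_digraph \<Rightarrow> ('a, 'b) gmonoid \<Rightarrow> bool" where
  "aperiodic G a \<longleftrightarrow> (\<exists>n > 0. succ G a (act n a))"

definition incomparable :: "('a, 'b) pre_digraph \<Rightarrow> ('a, 'b) gmonoid \<Rightarrow> bool" where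
  "incomparable G a \<longleftrightarrow> (\<forall>n > 0. \<not> precsim G a (act n a) \<and> \<not> precsim G (act n a) a)"

end

theory Submission
  imports Defs
begin

text \<open>
  Fix a finite set of edges along which generators may be expanded, and expand deterministically
  every monomial of level below \<open>N\<close>. Each relation (A1)--(A3) becomes an equality of multisets as
  soon as the finite set and \<open>N\<close> are large enough, so equivalent elements have equal expansions.
  Expanding never decreases the number of monomials. This gives \<open>c = 0\<close> whenever
  \<open>x\<^sup>n a \<sim> a + c\<close>, or \<open>a \<sim> b\<close> and \<open>a \<sim> b + c\<close>.

  If \<open>a \<sim> x\<^sup>n a + c\<close> with \<open>c \<noteq> 0\<close>, the size of the expansion of \<open>a\<close> is unbounded in \<open>N\<close>. Vertices of
  unbounded growth have a successor of unbounded growth and are finitely many, so they contain a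
  cycle, and a cycle without exit does not grow. If \<open>a \<sim> x\<^sup>n a\<close>, the size is bounded, but some
  generator of \<open>a\<close> must keep flowing since \<open>x\<^sup>n\<close> has no nonzero fixed point. Among the vertices that
  keep flowing with bounded size, those with the least bound emit exactly one edge, again to such
  a vertex, which yields a cycle without exit.
\<close>

section \<open>The shift action and the free monoid\<close>

lemma act_empty [simp]: "act n {#} = {#}"
  by (simp add: act_def)

lemma act_single [simp]: "act n {#(m, g)#} = {#(n + m, g)#}"
  by (simp add: act_def)

lemma act_plus [simp]: "act n (a + b) = act n a + act n b"
  by (simp add: act_def)

lemma act_add_mset [simp]: "act n (add_mset (m, g) a) = add_mset (n + m, g) (act n a)"
  by (simp add: act_def)

lemma act_act [simp]: "act m (act n a) = act (m + n) a"
  by (induction a) (auto simp: add.assoc)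

lemma act_sum: "act n (\<Sum>i\<in>I. f i) = (\<Sum>i\<in>I. act n (f i))"
  by (induction I rule: infinite_finite_induct) auto

lemma size_act [simp]: "size (act n a) = size a"
  by (simp add: act_def)

text \<open>The sum of the levels of all monomials rises by \<open>n * size a\<close> under
  \<open>act n\<close>, so a fixed element has size zero.\<close>

lemma act_fixed_imp_empty:
  assumes "act n a = a" and "n > 0"
  shows "a = {#}"
proof -
  have "(\<Sum>y\<in>#act n a. fst y) = (\<Sum>y\<in>#a. fst y) + n * int (size a)"
    by (induction a) (auto simp: algebra_simps)
  with assms show ?thesis by simp
qed

lemma size_multiset_sum:
  fixes f :: "'i \<Rightarrow> 'c multiset"
  shows "size (\<Sum>i\<in>I. f i) = (\<Sum>i\<in>I. size (f i))"
  by (induction I rule: infinite_finite_induct) auto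

lemma free_monoid_empty [simp]: "{#} \<in> free_monoid G"
  by (simp add: free_monoid_def)

lemma free_monoid_plus [simp]:
  "a + b \<in> free_monoid G \<longleftrightarrow> a \<in> free_monoid G \<and> b \<in> free_monoid G"
  by (auto simp: free_monoid_def)

lemma free_monoid_add_mset [simp]:
  "add_mset (m, g) a \<in> free_monoid G \<longleftrightarrow> g \<in> generators G \<and> a \<in> free_monoid G"
  by (auto simp: free_monoid_def)

lemma free_monoid_act [simp]: "act n a \<in> free_monoid G \<longleftrightarrow> a \<in> free_monoid G"
  by (induction a) auto

lemma free_monoid_sum:
  "(\<And>i. i \<in> I \<Longrightarrow> f i \<in> free_monoid G) \<Longrightarrow> (\<Sum>i\<in>I. f i) \<in> free_monoid G"
  by (induction I rule: infinite_finite_induct) auto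

lemma Proper_in_generators [simp]: "Proper v \<in> generators G \<longleftrightarrow> v \<in> verts G"
  by (auto simp: generators_def)

section \<open>Truncated unfolding\<close>

text \<open>
  A truncation keeps finitely many edges. Replacing \<open>v\<close> by the edges in \<open>X v\<close> is then an instance
  of (A1) or (A2), and \<open>X v = {}\<close> means that \<open>v\<close> is not expanded at all.
\<close>

definition truncation :: "('a, 'b) pre_digraph \<Rightarrow> ('a \<Rightarrow> 'b set) \<Rightarrow> bool" where
  "truncation G X \<longleftrightarrow> finite {v. X v \<noteq> {}} \<and>
    (\<forall>v. finite (X v) \<and> X v \<subseteq> out_arcs G v \<and> (regular G v \<longrightarrow> X v = {} \<or> X v = out_arcs G v))"

text \<open>The edges used in one expansion. An improper vertex is enlarged to \<open>X v\<close> by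
  (A3) if \<open>Z \<subseteq> X v\<close>, and is otherwise left alone.\<close>

fun pending :: "('a \<Rightarrow> 'b set) \<Rightarrow> ('a, 'b) generator \<Rightarrow> 'b set" where
  "pending X (Proper v) = X v"
| "pending X (Improper v Z) = (if Z \<subseteq> X v then X v - Z else {})"

fun residue :: "('a, 'b) pre_digraph \<Rightarrow> ('a \<Rightarrow> 'b set) \<Rightarrow> ('a, 'b) generator \<Rightarrow> ('a, 'b) gmonoid"
where
  "residue G X (Proper v) =
    (if X v = {} then {#(0, Proper v)#}
     else if regular G v then {#} else {#(0, Improper v (X v))#})"
| "residue G X (Improper v Z) = {#(0, Improper v (if Z \<subseteq> X v then X v else Z))#}"

text \<open>Only the heads of pending edges are unfolded further: every generator in a residue has
  no pending edges, so it is final.\<close>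

primrec unfold ::
  "('a, 'b) pre_digraph \<Rightarrow> ('a \<Rightarrow> 'b set) \<Rightarrow> nat \<Rightarrow> ('a, 'b) generator \<Rightarrow> ('a, 'b) gmonoid"
where
  "unfold G X 0 g = {#(0, g)#}"
| "unfold G X (Suc t) g =
    residue G X g + (\<Sum>e\<in>pending X g. act 1 (unfold G X t (Proper (head G e))))"

text \<open>Monomials of level at least \<open>N\<close> are left unchanged, because \<open>nat\<close> truncates.\<close>

definition flow ::
  "('a, 'b) pre_digraph \<Rightarrow> ('a \<Rightarrow> 'b set) \<Rightarrow> int \<Rightarrow> ('a, 'b) gmonoid \<Rightarrow> ('a, 'b) gmonoid" where
  "flow G X N a = (\<Sum>(m, g)\<in>#a. act m (unfold G X (nat (N - m)) g))"

lemma flow_empty [simp]: "flow G X N {#} = {#}"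
  by (simp add: flow_def)

lemma flow_plus [simp]: "flow G X N (a + b) = flow G X N a + flow G X N b"
  by (simp add: flow_def)

lemma flow_add_mset [simp]:
  "flow G X N (add_mset (m, g) a) = act m (unfold G X (nat (N - m)) g) + flow G X N a"
  by (simp add: flow_def)

lemma flow_sum: "flow G X N (\<Sum>i\<in>I. f i) = (\<Sum>i\<in>I. flow G X N (f i))"
  by (induction I rule: infinite_finite_induct) auto

text \<open>Only the distance from a level to the cutoff matters. Thus the flow of
  \<open>act n a\<close> is a shifted earlier stage of the flow of \<open>a\<close>, which links
  periodicity to growth in \<open>N\<close>.\<close>

lemma flow_act: "flow G X N (act n a) = act n (flow G X (N - n) a)"
  by (induction a) (auto simp: diff_diff_eq)

section \<open>Sizes of unfoldings\<close>

lemma finite_pending: "truncation G X \<Longrightarrow> finite (pending X g)"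
  by (cases g) (auto simp: truncation_def)

text \<open>The residue is empty only at an expanded regular vertex, and there some pending edge
  contributes by induction.\<close>

lemma size_unfold_pos:
  assumes "truncation G X"
  shows "size (unfold G X t g) \<ge> 1"
proof (induction t arbitrary: g)
  case (Suc t)
  show ?case
  proof (cases "residue G X g = {#}")
    case True
    then obtain e where e: "e \<in> pending X g"
      by (cases g) (auto split: if_splits)
    have "1 \<le> size (unfold G X t (Proper (head G e)))" by (rule Suc)
    also have "\<dots> \<le> (\<Sum>e\<in>pending X g. size (unfold G X t (Proper (head G e))))"
      using e finite_pending[OF assms] by (intro member_le_sum) auto
    finally show ?thesis by (simp add: size_multiset_sum)
  next
    case False
    then have "size (residue G X g) \<ge> 1" by (metis One_nat_def Suc_leI nonempty_has_size)
    then show ?thesis by simp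
  qed
qed simp

lemma size_unfold_Suc:
  "size (unfold G X (Suc t) g) =
    size (residue G X g) + (\<Sum>e\<in>pending X g. size (unfold G X t (Proper (head G e))))"
  by (simp add: size_multiset_sum)

lemma mono_size_unfold:
  assumes "truncation G X"
  shows "mono (\<lambda>t. size (unfold G X t g))"
proof (rule incseq_SucI)
  show "size (unfold G X t g) \<le> size (unfold G X (Suc t) g)" for t
  proof (induction t arbitrary: g)
    case 0
    then show ?case using size_unfold_pos[OF assms, of "Suc 0" g] by simp
  next
    case (Suc t)
    show ?case
      unfolding size_unfold_Suc[of G X "Suc t"]
      by (subst size_unfold_Suc) (intro add_left_mono sum_mono Suc)
  qed
qed

lemma size_flow_mono:
  assumes "truncation G X" and "N \<le> N'"
  shows "size (flow G X N a) \<le> size (flow G X N' a)"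
proof (induction a)
  case (add y a)
  then show ?case
    using monoD[OF mono_size_unfold[OF assms(1), of "snd y"],
        of "nat (N - fst y)" "nat (N' - fst y)"] assms(2)
    by (cases y) (simp add: add_mono nat_mono)
qed simp

lemma size_flow_ge:
  assumes "truncation G X"
  shows "size a \<le> size (flow G X N a)"
proof (induction a)
  case (add y a)
  then show ?case
    using size_unfold_pos[OF assms, of "nat (N - fst y)" "snd y"] by (cases y) simp
qed simp

lemma size_unfold_le_size_flow:
  assumes "(m, g) \<in># a"
  shows "size (unfold G X (nat (N - m)) g) \<le> size (flow G X N a)"
  using assms by (auto dest!: multi_member_split)

section \<open>Invariance of the flow and cancellation\<close>

lemma unfold_Improper:
  assumes "t > 0" and "Z \<subseteq> X v"
  shows "unfold G X t (Improper v Z) =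
    add_mset (0, Improper v (X v))
      (\<Sum>e\<in>X v - Z. act 1 (unfold G X (t - 1) (Proper (head G e))))"
  using assms by (cases t) auto

text \<open>The heads of the edges sit one level higher and have one stage fewer left, so they are
  flows with the same cutoff. The condition \<open>m < N\<close> guarantees at least one
  stage.\<close>

lemma flow_Improper:
  assumes "m < N" and "Z \<subseteq> X v"
  shows "flow G X N {#(m, Improper v Z)#} =
    add_mset (m, Improper v (X v)) (\<Sum>e\<in>X v - Z. flow G X N {#(m + 1, Proper (head G e))#})"
proof -
  have "nat (N - m) - 1 = nat (N - (m + 1))" and "0 < nat (N - m)" using assms by auto
  with assms show ?thesis by (simp add: unfold_Improper act_sum)
qed

lemma flow_Proper:
  assumes "m < N" and "X v \<noteq> {}"
  shows "flow G X N {#(m, Proper v)#} =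
    (if regular G v then {#} else {#(m, Improper v (X v))#})
      + (\<Sum>e\<in>X v. flow G X N {#(m + 1, Proper (head G e))#})"
proof -
  obtain k where k: "nat (N - m) = Suc k" using assms by (cases "nat (N - m)") auto
  then have "nat (N - (m + 1)) = k" by linarith
  with k assms show ?thesis by (simp add: act_sum)
qed

text \<open>The cutoff \<open>m + 1\<close> ensures that the rewritten monomial is expanded, and
  \<open>X0\<close> contains the edges the relation uses. For any larger truncation both sides
  expand to all of \<open>X v\<close>.\<close>

lemma flow_step:
  assumes "step G a b"
  shows "\<exists>N0 X0. truncation G X0 \<and>
    (\<forall>N\<ge>N0. \<forall>X. truncation G X \<longrightarrow> X0 \<le> X \<longrightarrow> flow G X N a = flow G X N b)"
  using assms
proof cases
  case (A1 c v m)
  define X0 where "X0 = (\<lambda>_. {})(v := out_arcs G v)"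
  have "truncation G X0"
    using A1 by (auto simp: truncation_def X0_def regular_def)
  moreover have "flow G X N a = flow G X N b"
    if "N \<ge> m + 1" "truncation G X" "X0 \<le> X" for N X
  proof -
    \<comment> \<open>At a regular vertex a truncation keeps all edges or none, and
      \<open>X0 \<le> X\<close> excludes none.\<close>
    have X: "X v = out_arcs G v"
      using that A1 by (auto simp: truncation_def X0_def regular_def le_fun_def split: if_splits)
    then have "X v \<noteq> {}" using A1 by (simp add: regular_def)
    from flow_Proper[of m N X v G] this that(1) X A1 show ?thesis
      unfolding A1(1,2) flow_plus flow_sum by (simp del: flow_add_mset)
  qed
  ultimately show ?thesis by blast
next
  case (A2 c v Z m)
  define X0 where "X0 = (\<lambda>_. {})(v := Z)"
  have nreg: "\<not> regular G v" using A2 by (auto simp: regular_def infinite_emitter_def)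
  then have "truncation G X0"
    using A2 by (auto simp: truncation_def X0_def)
  moreover have "flow G X N a = flow G X N b"
    if "N \<ge> m + 1" "truncation G X" "X0 \<le> X" for N X
  proof -
    have X: "Z \<subseteq> X v" "finite (X v)" "X v \<noteq> {}"
      using that A2 by (auto simp: truncation_def X0_def le_fun_def split: if_splits)
    \<comment> \<open>Both sides leave \<open>Improper v (X v)\<close>. On the right the edges of
      \<open>Z\<close> are already present and the improper vertex supplies those of
      \<open>X v - Z\<close>.\<close>
    from flow_Proper[of m N X v G] flow_Improper[of m N Z X v G] that(1) X nreg
    show ?thesis
      unfolding A2(1,2) flow_plus flow_sum
      by (simp add: sum.subset_diff[OF X(1,2)] del: flow_add_mset)
  qed
  ultimately show ?thesis by blast
next
  case (A3 c v Z W m)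
  define X0 where "X0 = (\<lambda>_. {})(v := W)"
  have "\<not> regular G v" using A3 by (auto simp: regular_def infinite_emitter_def)
  then have "truncation G X0"
    using A3 by (auto simp: truncation_def X0_def)
  moreover have "flow G X N a = flow G X N b"
    if "N \<ge> m + 1" "truncation G X" "X0 \<le> X" for N X
  proof -
    have X: "W \<subseteq> X v" "Z \<subseteq> X v" "finite (X v)"
      using that A3 by (auto simp: truncation_def X0_def le_fun_def split: if_splits)
    have "X v - Z = (X v - W) \<union> (W - Z)" using A3 X by auto
    then have "(\<Sum>e\<in>X v - Z. flow G X N {#(m + 1, Proper (head G e))#}) =
        (\<Sum>e\<in>X v - W. flow G X N {#(m + 1, Proper (head G e))#})
        + (\<Sum>e\<in>W - Z. flow G X N {#(m + 1, Proper (head G e))#})"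
      using A3 X by (simp only:) (intro sum.union_disjoint; auto)
    with flow_Improper[of m N W X v G] flow_Improper[of m N Z X v G] that(1) X(1,2)
    show ?thesis
      unfolding A3(1,2) flow_plus flow_sum by (simp del: flow_add_mset)
  qed
  ultimately show ?thesis by blast
qed

text \<open>Truncations are directed upwards, so two thresholds have a common one.\<close>

lemma truncation_sup:
  assumes "truncation G X" and "truncation G Y"
  shows "truncation G (sup X Y)"
proof -
  have "{v. X v \<union> Y v \<noteq> {}} = {v. X v \<noteq> {}} \<union> {v. Y v \<noteq> {}}" by auto
  then show ?thesis
    using assms unfolding truncation_def by (simp add: sup_fun_def) blast
qed

text \<open>
  Equivalence in the monoid becomes equality of multisets; this takes the place of confluence of
  the rewriting relation.
\<close>

lemma flow_sim:
  assumes "sim G a b"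
  shows "\<exists>N0 X0. truncation G X0 \<and>
    (\<forall>N\<ge>N0. \<forall>X. truncation G X \<longrightarrow> X0 \<le> X \<longrightarrow> flow G X N a = flow G X N b)"
  using assms
proof induction
  case (base a b)
  then show ?case by (rule flow_step)
next
  case (refl a)
  have "truncation G (\<lambda>_. {})" by (simp add: truncation_def)
  then show ?case by blast
next
  case (sym a b)
  then show ?case by metis
next
  case (trans a b c)
  from trans.IH obtain N0 X0 N1 X1 where
    "truncation G X0"
    "\<And>N X. N \<ge> N0 \<Longrightarrow> truncation G X \<Longrightarrow> X0 \<le> X \<Longrightarrow> flow G X N a = flow G X N b"
    "truncation G X1"
    "\<And>N X. N \<ge> N1 \<Longrightarrow> truncation G X \<Longrightarrow> X1 \<le> X \<Longrightarrow> flow G X N b = flow G X N c"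
    by blast
  then show ?case
    by (intro exI[of _ "max N0 N1"] exI[of _ "sup X0 X1"] conjI truncation_sup)
      (auto simp del: sup_apply)
next
  case (add a b c)
  then show ?case by auto
next
  case (act a b n)
  then obtain N0 X0 where
    "truncation G X0"
    "\<And>N X. N \<ge> N0 \<Longrightarrow> truncation G X \<Longrightarrow> X0 \<le> X \<Longrightarrow> flow G X N a = flow G X N b"
    by blast
  then show ?case
    by (intro exI[of _ "N0 + n"] exI[of _ X0]) (simp add: flow_act)
qed

text \<open>At a common threshold the flows of \<open>b\<close> and \<open>b + c\<close> coincide,
  while the flow of \<open>c\<close> has at least \<open>size c\<close> monomials.\<close>

lemma sim_plus_cancel:
  assumes "sim G a b" and "sim G a (b + c)"
  shows "c = {#}"
proof -
  from flow_sim[OF assms(1)] flow_sim[OF assms(2)] obtain N0 X0 N1 X1 where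
    *: "truncation G X0" "truncation G X1"
    "\<And>N X. N \<ge> N0 \<Longrightarrow> truncation G X \<Longrightarrow> X0 \<le> X \<Longrightarrow> flow G X N a = flow G X N b"
    "\<And>N X. N \<ge> N1 \<Longrightarrow> truncation G X \<Longrightarrow> X1 \<le> X \<Longrightarrow> flow G X N a = flow G X N (b + c)"
    by blast
  define N X where "N = max N0 N1" and "X = sup X0 X1"
  have X: "truncation G X" using * by (simp add: X_def truncation_sup)
  have "flow G X N b = flow G X N b + flow G X N c"
    using *(3,4)[of N X] X by (simp add: N_def X_def)
  then show ?thesis using size_flow_ge[OF X, of c N] by simp
qed

text \<open>A shift by \<open>n > 0\<close> lowers the cutoff and so cannot enlarge the flow, which
  leaves no room for \<open>c\<close>.\<close>

lemma sim_act_plus_cancel: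
  assumes "sim G (act n a) (a + c)" and "n > 0"
  shows "c = {#}"
proof -
  from flow_sim[OF assms(1)] obtain N X where
    X: "truncation G X" and "flow G X N (act n a) = flow G X N (a + c)"
    by blast
  then have "size (flow G X (N - n) a) = size (flow G X N a) + size (flow G X N c)"
    by (metis flow_act flow_plus size_act size_union)
  moreover have "size (flow G X (N - n) a) \<le> size (flow G X N a)"
    using assms X by (intro size_flow_mono) auto
  ultimately show ?thesis using size_flow_ge[OF X, of c N] by simp
qed

section \<open>Cycles\<close>

lemma cycle_in_finite_set:
  assumes "wf_digraph G" and "finite W" and "W \<noteq> {}"
    and f: "\<And>v. v \<in> W \<Longrightarrow> f v \<in> out_arcs G v \<and> head G (f v) \<in> W"
  obtains p where "pre_digraph.cycle G p" and "set p \<subseteq> f ` W"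
proof -
  interpret wf_digraph G by fact
  define h where "h = (\<lambda>v. head G (f v))"
  obtain w where "w \<in> W" using assms by auto
  then have W: "(h ^^ i) w \<in> W" for i
    by (induction i) (auto simp: h_def f)
  have "\<not> inj (\<lambda>i. (h ^^ i) w)"
    using W assms(2) by (meson finite_subset image_subsetI infinite_UNIV_nat finite_imageD)
  then obtain i j where "i < j" and ij: "(h ^^ i) w = (h ^^ j) w"
    unfolding inj_def by (metis linorder_neqE_nat)
  define u where "u = (h ^^ i) w"
  have u: "(h ^^ k) u \<in> W" for k
    unfolding u_def using W[of "k + i"] by (simp add: funpow_add)
  have "(h ^^ (j - i)) u = (h ^^ (j - i + i)) w" by (simp only: u_def funpow_add comp_apply)
  also have "\<dots> = u" using ij \<open>i < j\<close> by (simp add: u_def)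
  finally have "(h ^^ (j - i)) u = u" .
  then have ex: "\<exists>k. 0 < k \<and> (h ^^ k) u = u" using \<open>i < j\<close> by (intro exI[of _ "j - i"]) simp
  define k where "k = (LEAST k. 0 < k \<and> (h ^^ k) u = u)"
  have k: "0 < k" "(h ^^ k) u = u" using LeastI_ex[OF ex] by (auto simp: k_def)
  have kmin: "(h ^^ l) u \<noteq> u" if "0 < l" "l < k" for l
    using that not_less_Least[of l "\<lambda>k. 0 < k \<and> (h ^^ k) u = u"] by (auto simp: k_def)
  define p where "p = (\<lambda>l. map (\<lambda>i. f ((h ^^ i) u)) [0..<l])"
  have walk: "awalk u (p l) ((h ^^ l) u)" for l
  proof (induction l)
    case 0
    have "f u \<in> arcs G" "tail G (f u) = u" using f[of u] u[of 0] by auto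
    then have "u \<in> verts G" using tail_in_verts by metis
    then show ?case by (simp add: p_def awalk_Nil_iff)
  next
    case (Suc l)
    have "awalk ((h ^^ l) u) [f ((h ^^ l) u)] ((h ^^ Suc l) u)"
      using arc_implies_awalk[of "f ((h ^^ l) u)"] f[OF u[of l]] by (simp add: h_def)
    with Suc show ?case by (simp add: p_def awalk_appendI)
  qed
  have tails: "map (tail G) (p k) = map (\<lambda>i. (h ^^ i) u) [0..<k]"
    using f u by (simp add: p_def)
  have "distinct (map (tail G) (p k))"
  proof -
    \<comment> \<open>A coincidence at \<open>i < j\<close>, advanced by \<open>k - j\<close>
      further iterations, would give the period \<open>k - j + i\<close>, smaller than
      \<open>k\<close>.\<close>
    have "(h ^^ i) u \<noteq> (h ^^ j) u" if "i < j" "j < k" for i j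
    proof
      assume eq: "(h ^^ i) u = (h ^^ j) u"
      have "(h ^^ (k - j + i)) u = (h ^^ (k - j)) ((h ^^ i) u)" by (simp add: funpow_add)
      also have "\<dots> = (h ^^ (k - j + j)) u" by (simp add: funpow_add eq)
      also have "\<dots> = u" using that k by simp
      finally have "(h ^^ (k - j + i)) u = u" .
      with kmin[of "k - j + i"] that show False by linarith
    qed
    then have "inj_on (\<lambda>i. (h ^^ i) u) {0..<k}"
      by (intro linorder_inj_onI) auto
    then show ?thesis by (simp add: tails distinct_map)
  qed
  then have "cycle (p k)"
    using walk[of k] k by (auto simp: cycle_iff_distinct_sources p_def)
  moreover have "set (p k) \<subseteq> f ` W" using u by (auto simp: p_def)
  ultimately show ?thesis using that by blast
qed

text \<open>Sources on a cycle are distinct, so each vertex emits exactly one edge of the cycle; any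
  other edge it emits is an exit.\<close>

lemma has_exit_iff:
  assumes "pre_digraph.cycle G p"
  shows "has_exit G p \<longleftrightarrow> \<not> (\<forall>e\<in>set p. out_arcs G (tail G e) = {e})"
proof -
  have inj: "inj_on (tail G) (set p)" and sub: "set p \<subseteq> arcs G"
    using assms by (auto simp: cycle_iff_distinct_sources pre_digraph.awalk_def distinct_map)
  have "out_arcs G (tail G e) - set p = out_arcs G (tail G e) - {e}" if "e \<in> set p" for e
    using that by (auto dest: inj_onD[OF inj])
  moreover have "has_exit G p \<longleftrightarrow> (\<exists>e\<in>set p. out_arcs G (tail G e) - set p \<noteq> {})"
  proof
    assume "has_exit G p"
    then obtain d e where "d \<in> arcs G" "e \<in> set p" "tail G d = tail G e" "d \<notin> set p"
      unfolding has_exit_def by blast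
    then have "d \<in> out_arcs G (tail G e) - set p" by simp
    with \<open>e \<in> set p\<close> show "\<exists>e\<in>set p. out_arcs G (tail G e) - set p \<noteq> {}" by blast
  next
    assume "\<exists>e\<in>set p. out_arcs G (tail G e) - set p \<noteq> {}"
    then obtain d e where "e \<in> set p" "d \<in> out_arcs G (tail G e) - set p" by blast
    then show "has_exit G p" unfolding has_exit_def by (intro bexI[of _ d]) auto
  qed
  moreover have "out_arcs G (tail G e) - {e} \<noteq> {} \<longleftrightarrow> out_arcs G (tail G e) \<noteq> {e}"
    if "e \<in> set p" for e
  proof -
    have "e \<in> out_arcs G (tail G e)" using sub that by auto
    then show ?thesis by blast
  qed
  ultimately show ?thesis by simp
qed

section \<open>Relations along edges, walks and cycles\<close>

text \<open>For finitely many edges, (A1) applies and \<open>c\<close> collects the heads of the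
  other edges. For infinitely many, (A2) with \<open>Z = {e}\<close> applies and \<open>c\<close> is
  the improper vertex, never zero.\<close>

lemma sim_edge:
  assumes "wf_digraph G" and "e \<in> arcs G"
  shows "\<exists>c \<in> free_monoid G.
    sim G {#(m, Proper (tail G e))#} ({#(m + 1, Proper (head G e))#} + c) \<and>
    (c = {#} \<longleftrightarrow> out_arcs G (tail G e) = {e})"
proof -
  interpret wf_digraph G by fact
  let ?v = "tail G e"
  have v: "?v \<in> verts G" and e: "e \<in> out_arcs G ?v" using assms by auto
  show ?thesis
  proof (cases "finite (out_arcs G ?v)")
    case True
    define c :: "('a, 'b) gmonoid"
      where "c = (\<Sum>e\<in>out_arcs G ?v - {e}. {#(m + 1, Proper (head G e))#})"
    have "regular G ?v" using True v e by (auto simp: regular_def)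
    then have "sim G {#(m, Proper ?v)#} ({#(m + 1, Proper (head G e))#} + c)"
      using sim.base[OF step.A1[of "{#}" G ?v m]] True e by (simp add: c_def sum.remove)
    moreover have "c = {#} \<longleftrightarrow> out_arcs G ?v - {e} = {}"
      using True by (simp add: c_def size_multiset_sum flip: size_eq_0_iff_empty)
    then have "c = {#} \<longleftrightarrow> out_arcs G ?v = {e}" using e by blast
    moreover have "c \<in> free_monoid G"
      unfolding c_def by (intro free_monoid_sum) auto
    ultimately show ?thesis by (intro bexI[of _ c] conjI)
  next
    case False
    then have inf: "infinite_emitter G ?v" using v by (simp add: infinite_emitter_def)
    then have "sim G {#(m, Proper ?v)#}
        ({#(m + 1, Proper (head G e))#} + {#(m, Improper ?v {e})#})"
      using sim.base[OF step.A2[of "{#}" G ?v "{e}" m]] e by (simp add: add_mset_commute)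
    moreover have "{#(m, Improper ?v {e})#} \<in> free_monoid G"
      using inf e by (auto simp: generators_def)
    moreover have "out_arcs G ?v \<noteq> {e}" using False by auto
    ultimately show ?thesis
      by (intro bexI[of _ "{#(m, Improper ?v {e})#}"] conjI) simp_all
  qed
qed

text \<open>The remainders of the single edges add up, and a sum of multisets is empty only if each
  summand is.\<close>

lemma sim_awalk:
  assumes "wf_digraph G" and "pre_digraph.awalk G u p w"
  shows "\<exists>c \<in> free_monoid G.
    sim G {#(m, Proper u)#} ({#(m + int (length p), Proper w)#} + c) \<and>
    (c = {#} \<longleftrightarrow> (\<forall>e\<in>set p. out_arcs G (tail G e) = {e}))"
  using assms(2)
proof (induction p arbitrary: u m)
  case Nil
  interpret wf_digraph G by fact
  have "u = w" "u \<in> verts G" using Nil by (auto simp: awalk_Nil_iff)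
  then show ?case
    by (intro bexI[of _ "{#}"]) (auto intro: sim.refl)
next
  case (Cons e p)
  interpret wf_digraph G by fact
  have e: "e \<in> arcs G" "tail G e = u" and p: "awalk (head G e) p w"
    using Cons.prems by (auto simp: awalk_Cons_iff)
  obtain c where c: "c \<in> free_monoid G" "c = {#} \<longleftrightarrow> out_arcs G (tail G e) = {e}"
    "sim G {#(m, Proper u)#} ({#(m + 1, Proper (head G e))#} + c)"
    using sim_edge[OF assms(1) e(1), of m] e by blast
  obtain d where d: "d \<in> free_monoid G"
    "d = {#} \<longleftrightarrow> (\<forall>e\<in>set p. out_arcs G (tail G e) = {e})"
    "sim G {#(m + 1, Proper (head G e))#} ({#(m + 1 + int (length p), Proper w)#} + d)"
    using Cons.IH[OF p, of "m + 1"] by blast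
  have len: "m + 1 + int (length p) = m + int (length (e # p))" by simp
  have "sim G {#(m, Proper u)#} ({#(m + int (length (e # p)), Proper w)#} + (d + c))"
    using sim.trans[OF c(3) sim.add[OF d(3) c(1)]] by (simp only: len union_assoc)
  moreover have "d + c \<in> free_monoid G" using c d by simp
  moreover have "d + c = {#} \<longleftrightarrow> (\<forall>e\<in>set (e # p). out_arcs G (tail G e) = {e})"
    using c d by auto
  ultimately show ?case by (intro bexI[of _ "d + c"] conjI)
qed

lemma sim_cycle:
  assumes "wf_digraph G" and "pre_digraph.cycle G p"
  obtains a c n where "a \<in> free_monoid G" "a \<noteq> {#}" "c \<in> free_monoid G" "n > 0"
    "sim G a (act n a + c)" "c \<noteq> {#} \<longleftrightarrow> has_exit G p"
proof -
  interpret wf_digraph G by fact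
  obtain u where w: "awalk u p u" and "p \<noteq> []"
    using assms(2) by (auto simp: cycle_iff_distinct_sources)
  obtain c where "c \<in> free_monoid G"
    "sim G {#(0, Proper u)#} ({#(0 + int (length p), Proper u)#} + c)"
    "c = {#} \<longleftrightarrow> (\<forall>e\<in>set p. out_arcs G (tail G e) = {e})"
    using sim_awalk[OF assms(1) w, of 0] by blast
  moreover have "u \<in> verts G" using w by (simp add: awalk_def)
  moreover have "act (int (length p)) {#(0, Proper u)#} = {#(0 + int (length p), Proper u)#}"
    by simp
  ultimately show ?thesis
    using \<open>p \<noteq> []\<close> has_exit_iff[OF assms(2)]
    by (intro that[of "{#(0, Proper u)#}" c "int (length p)"]; simp)
qed

section \<open>Growth\<close>

abbreviation bounded_unfold ::
  "('a, 'b) pre_digraph \<Rightarrow> ('a \<Rightarrow> 'b set) \<Rightarrow> ('a, 'b) generator \<Rightarrow> nat \<Rightarrow> bool" where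
  "bounded_unfold G X g k \<equiv> \<forall>t. size (unfold G X t g) \<le> k"

text \<open>Used in contrapositive form: unbounded growth passes from a generator to the head of a
  pending edge.\<close>

lemma bounded_unfold_children:
  assumes "truncation G X" and "\<And>e. e \<in> pending X g \<Longrightarrow> \<exists>k. bounded_unfold G X (Proper (head G e)) k"
  shows "\<exists>k. bounded_unfold G X g k"
proof -
  from assms(2) obtain k where k: "\<And>e t. e \<in> pending X g \<Longrightarrow>
      size (unfold G X t (Proper (head G e))) \<le> k e"
    by metis
  \<comment> \<open>The summand \<open>1\<close> covers stage zero, where the generator itself is
    the whole unfolding.\<close>
  have "size (unfold G X t g) \<le> 1 + (size (residue G X g) + (\<Sum>e\<in>pending X g. k e))" for t
    using k by (cases t) (auto simp: size_multiset_sum intro: sum_mono le_SucI)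
  then show ?thesis by blast
qed

lemma truncation_finite: "truncation G X \<Longrightarrow> finite {v. X v \<noteq> {}}"
  by (simp add: truncation_def)

lemma truncation_arc:
  assumes "truncation G X" and "e \<in> X v"
  shows "e \<in> out_arcs G v"
  using assms unfolding truncation_def by blast

text \<open>Every vertex of \<open>W\<close> is regular with one edge, so expanding it leaves no
  residue and a single monomial moves along \<open>W\<close>.\<close>

lemma size_unfold_no_branching:
  assumes "truncation G X" and "\<And>v. v \<in> W \<Longrightarrow> \<exists>e. out_arcs G v = {e} \<and> head G e \<in> W \<and> v \<in> verts G"
    and "v \<in> W"
  shows "size (unfold G X t (Proper v)) = 1"
  using assms(3)
proof (induction t arbitrary: v)
  case (Suc t)
  obtain e where e: "out_arcs G v = {e}" "head G e \<in> W" "v \<in> verts G"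
    using assms(2)[OF Suc.prems] by blast
  then have "regular G v" by (simp add: regular_def)
  moreover from this have "X v = {} \<or> X v = {e}"
    using assms(1) e by (auto simp: truncation_def)
  ultimately show ?case using Suc.IH[OF e(2)] by auto
qed simp

lemma unbounded_imp_cycle_with_exit:
  assumes "wf_digraph G" and X: "truncation G X" and "\<nexists>k. bounded_unfold G X g k"
  obtains p where "pre_digraph.cycle G p" "has_exit G p"
proof -
  interpret wf_digraph G by fact
  define U where "U = {v. \<nexists>k. bounded_unfold G X (Proper v) k}"
  have child: "\<exists>e\<in>pending X g. head G e \<in> U" if "\<nexists>k. bounded_unfold G X g k" for g
    using bounded_unfold_children[OF X, of g] that unfolding U_def by blast
  have "\<exists>e\<in>X v. head G e \<in> U" if "v \<in> U" for v
  proof -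
    have "\<nexists>k. bounded_unfold G X (Proper v) k" using that unfolding U_def by blast
    from child[OF this] show ?thesis by simp
  qed
  then obtain f where f: "\<And>v. v \<in> U \<Longrightarrow> f v \<in> X v \<and> head G (f v) \<in> U" by metis
  have "U \<subseteq> {v. X v \<noteq> {}}" using f by auto
  then have "finite U" using truncation_finite[OF X] by (rule finite_subset)
  moreover have "U \<noteq> {}" using child[OF assms(3)] by auto
  moreover have "f v \<in> out_arcs G v \<and> head G (f v) \<in> U" if "v \<in> U" for v
    using f[OF that] truncation_arc[OF X] by blast
  ultimately obtain p where p: "cycle p" "set p \<subseteq> f ` U"
    using cycle_in_finite_set[OF assms(1), of U f] by blast
  have "has_exit G p"
  proof (rule ccontr)
    assume "\<not> has_exit G p"
    then have single: "out_arcs G (tail G e) = {e}" if "e \<in> set p" for e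
      using has_exit_iff[OF p(1)] that by blast
    obtain u where w: "awalk u p u" "p \<noteq> []"
      using p by (auto simp: cycle_iff_distinct_sources)
    \<comment> \<open>On a closed walk heads and tails agree, so the vertices of the cycle are
      closed under its edges, as non-branching requires.\<close>
    have ht: "set (map (head G) p) = set (map (tail G) p)"
      using cas_mset_heads_tails[of G u p u] w
      by (metis add_mset_add_mset_same_iff awalk_def set_mset_mset)
    have "\<exists>e. out_arcs G v = {e} \<and> head G e \<in> tail G ` set p \<and> v \<in> verts G"
      if "v \<in> tail G ` set p" for v
    proof -
      from that obtain e where e: "e \<in> set p" "v = tail G e" by auto
      moreover have "head G e \<in> tail G ` set p" using e ht by auto
      moreover have "tail G e \<in> verts G" using single[OF e(1)] tail_in_verts by fastforce
      ultimately show ?thesis using single[OF e(1)] by auto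
    qed
    then have "size (unfold G X t (Proper v)) = 1" if "v \<in> tail G ` set p" for t v
      using that by (rule size_unfold_no_branching[OF X])
    then have "bounded_unfold G X (Proper v) 1" if "v \<in> tail G ` set p" for v
      using that by simp
    moreover have "hd p \<in> set p" using w by simp
    moreover from this have "tail G (hd p) \<in> U"
      using p(2) f truncation_arc[OF X] by fastforce
    ultimately show False unfolding U_def by blast
  qed
  with p that show ?thesis by blast
qed

lemma bounded_flow:
  assumes X: "truncation G X" and "\<And>g m. (m, g) \<in># a \<Longrightarrow> \<exists>k. bounded_unfold G X g k"
  shows "\<exists>k. \<forall>N. size (flow G X N a) \<le> k"
  using assms(2)
proof (induction a)
  case (add y a)
  obtain m g where y: "y = (m, g)" by force
  have "\<exists>k. bounded_unfold G X h k" if "(i, h) \<in># a" for i h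
    using that by (intro add.prems[of i h]) simp
  then obtain k where "\<forall>N. size (flow G X N a) \<le> k" using add.IH by blast
  moreover obtain l where "bounded_unfold G X g l" using add.prems[of m g] y by auto
  ultimately have "size (flow G X N (add_mset y a)) \<le> l + k" for N
    by (simp add: y add_mono)
  then show ?case by blast
qed simp

lemma aperiodic_imp_cycle_with_exit:
  assumes "wf_digraph G" and "sim G a (act n a + c)" and "n > 0" and "c \<noteq> {#}"
  obtains p where "pre_digraph.cycle G p" "has_exit G p"
proof -
  from flow_sim[OF assms(2)] obtain N0 X where X: "truncation G X"
    and eq: "\<And>N. N \<ge> N0 \<Longrightarrow> flow G X N a = flow G X N (act n a + c)"
    by blast
  have grow: "size (flow G X (N - n) a) + 1 \<le> size (flow G X N a)" if "N \<ge> N0" for N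
  proof -
    have "1 \<le> size c" using assms(4) by (simp add: Suc_leI flip: nonempty_has_size)
    with eq[OF that] size_flow_ge[OF X, of c N] show ?thesis by (simp add: flow_act)
  qed
  \<comment> \<open>Each increase of the cutoff by \<open>n\<close> adds at least one monomial,
    coming from \<open>c\<close>.\<close>
  have "i \<le> size (flow G X (N0 + int i * n) a)" for i
  proof (induction i)
    case (Suc i)
    have "0 \<le> int (Suc i) * n" using assms(3) by simp
    then show ?case
      using Suc grow[of "N0 + int (Suc i) * n"] by (simp add: algebra_simps)
  qed simp
  then have "\<nexists>k. \<forall>N. size (flow G X N a) \<le> k" by (meson Suc_n_not_le_n le_trans)
  then obtain g where "\<nexists>k. bounded_unfold G X g k"
    using bounded_flow[OF X, of a] by blast
  from unbounded_imp_cycle_with_exit[OF assms(1) X this] that show ?thesis by blast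
qed

section \<open>Dying generators and periodic elements\<close>

text \<open>Well-foundedness: no infinite path of pending edges starts at \<open>g\<close>. A
  generator that does not die has a pending edge whose head does not die.\<close>

inductive dies :: "('a, 'b) pre_digraph \<Rightarrow> ('a \<Rightarrow> 'b set) \<Rightarrow> ('a, 'b) generator \<Rightarrow> bool" for G X where
  "(\<And>e. e \<in> pending X g \<Longrightarrow> dies G X (Proper (head G e))) \<Longrightarrow> dies G X g"

text \<open>There are finitely many pending edges, and by induction each head has a stage after
  which it no longer changes.\<close>

lemma dies_imp_stationary:
  assumes X: "truncation G X" and "dies G X g"
  shows "\<exists>T. \<forall>t\<ge>T. unfold G X t g = unfold G X T g"
  using assms(2)
proof induction
  case (1 g)
  then have "\<forall>e\<in>pending X g. \<exists>T. \<forall>t\<ge>T.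
      unfold G X t (Proper (head G e)) = unfold G X T (Proper (head G e))"
    by blast
  from bchoice[OF this] obtain T where T: "\<And>e t. e \<in> pending X g \<Longrightarrow> t \<ge> T e \<Longrightarrow>
      unfold G X t (Proper (head G e)) = unfold G X (T e) (Proper (head G e))"
    by blast
  define M where "M = (\<Sum>e\<in>pending X g. T e)"
  have M: "T e \<le> M" if "e \<in> pending X g" for e
    unfolding M_def using that finite_pending[OF X] by (intro member_le_sum) auto
  have "unfold G X t g = unfold G X (Suc M) g" if t: "t \<ge> Suc M" for t
  proof -
    obtain s where s: "t = Suc s" "s \<ge> M" using t by (cases t) auto
    have "unfold G X s (Proper (head G e)) = unfold G X M (Proper (head G e))"
      if "e \<in> pending X g" for e
      using T[OF that, of s] T[OF that, of M] M[OF that] s by simp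
    then show ?thesis using s by simp
  qed
  then show ?case by blast
qed

lemma dies_imp_flow_stationary:
  assumes X: "truncation G X" and "\<And>g m. (m, g) \<in># a \<Longrightarrow> dies G X g"
  shows "\<exists>M. \<forall>N\<ge>M. flow G X N a = flow G X M a"
  using assms(2)
proof (induction a)
  case (add y a)
  obtain m g where y: "y = (m, g)" by force
  have "dies G X h" if "(i, h) \<in># a" for i h
    using that by (intro add.prems[of i h]) simp
  then obtain M where M: "\<And>N. N \<ge> M \<Longrightarrow> flow G X N a = flow G X M a"
    using add.IH by blast
  obtain T where T: "\<And>t. t \<ge> T \<Longrightarrow> unfold G X t g = unfold G X T g"
    using dies_imp_stationary[OF X, of g] add.prems[of m g] y by auto
  have *: "flow G X N (add_mset y a) = act m (unfold G X T g) + flow G X M a"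
    if "N \<ge> max M (m + int T)" for N
  proof -
    have "T \<le> nat (N - m)" "M \<le> N" using that by auto
    then show ?thesis using M[of N] T[of "nat (N - m)"] y by simp
  qed
  show ?case
  proof (intro exI allI impI)
    fix N assume "N \<ge> max M (m + int T)"
    then show "flow G X N (add_mset y a) = flow G X (max M (m + int T)) (add_mset y a)"
      using *[of N] *[of "max M (m + int T)"] by (simp only: order_refl)
  qed
qed simp

lemma periodic_imp_cycle_without_exit:
  assumes "wf_digraph G" and sim: "sim G a (act n a)" and n: "n > 0" and "a \<noteq> {#}"
  obtains p where "pre_digraph.cycle G p" "\<not> has_exit G p"
proof -
  interpret wf_digraph G by fact
  from flow_sim[OF sim] obtain N0 X where X: "truncation G X"
    and "\<And>N. N \<ge> N0 \<Longrightarrow> flow G X N a = flow G X N (act n a)"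
    by blast
  then have eq: "flow G X N a = act n (flow G X (N - n) a)" if "N \<ge> N0" for N
    using that by (simp add: flow_act)
  \<comment> \<open>Along cutoffs spaced by \<open>n\<close> each flow is a shift of the previous
    one. By monotonicity in the cutoff, this bounds the size at every cutoff.\<close>
  have const: "size (flow G X (N0 + int i * n) a) = size (flow G X N0 a)" for i
  proof (induction i)
    case (Suc i)
    have "0 \<le> int (Suc i) * n" using n by simp
    then show ?case
      using Suc eq[of "N0 + int (Suc i) * n"] by (simp add: algebra_simps)
  qed simp
  have bounded_a: "\<exists>k. bounded_unfold G X g k" if "(m, g) \<in># a" for m g
  proof -
    have "size (unfold G X t g) \<le> size (flow G X N0 a)" for t
    proof -
      \<comment> \<open>Since \<open>n \<ge> 1\<close>, this many periods lift the cutoff from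
        \<open>N0\<close> to at least \<open>m + int t\<close>.\<close>
      define i where "i = nat (max 0 (m + int t - N0))"
      have "m + int t \<le> N0 + int i * 1" by (simp add: i_def)
      also have "\<dots> \<le> N0 + int i * n" using n by (intro add_left_mono mult_left_mono) auto
      finally have le: "m + int t \<le> N0 + int i * n" .
      have "size (unfold G X t g) \<le> size (flow G X (m + int t) a)"
        using size_unfold_le_size_flow[OF that, of G X "m + int t"] by simp
      also have "\<dots> \<le> size (flow G X (N0 + int i * n) a)" by (rule size_flow_mono[OF X le])
      finally show ?thesis by (simp add: const)
    qed
    then show ?thesis by blast
  qed
  \<comment> \<open>If all generators of \<open>a\<close> died, the flow would be constant for large
    cutoffs and hence fixed by \<open>act n\<close>, so empty, although it has at least
    \<open>size a\<close> monomials.\<close>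
  have "\<exists>m g. (m, g) \<in># a \<and> \<not> dies G X g"
  proof (rule ccontr)
    assume "\<nexists>m g. (m, g) \<in># a \<and> \<not> dies G X g"
    then obtain M where M: "\<And>N. N \<ge> M \<Longrightarrow> flow G X N a = flow G X M a"
      using dies_imp_flow_stationary[OF X, of a] by blast
    have "act n (flow G X M a) = flow G X M a"
      using eq[of "max M N0 + n"] M[of "max M N0 + n"] M[of "max M N0"] n by simp
    then have "flow G X M a = {#}" using n by (rule act_fixed_imp_empty)
    then show False using size_flow_ge[OF X, of a M] \<open>a \<noteq> {#}\<close> by simp
  qed
  then obtain g where g: "\<not> dies G X g" "\<exists>k. bounded_unfold G X g k" using bounded_a by blast
  \<comment> \<open>The head of one pending edge is smaller than \<open>g\<close> by at least the
    residue plus one for each other pending edge. The \<open>- 1\<close> removes \<open>e\<close>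
    itself.\<close>
  have drop: "size (unfold G X t (Proper (head G e))) +
        (size (residue G X g) + card (pending X g) - 1)
      \<le> size (unfold G X (Suc t) g)" if "e \<in> pending X g" for e g t
  proof -
    have "card (pending X g - {e}) \<le>
        (\<Sum>d\<in>pending X g - {e}. size (unfold G X t (Proper (head G d))))"
      unfolding card_eq_sum by (intro sum_mono size_unfold_pos[OF X])
    moreover have "card (pending X g) = Suc (card (pending X g - {e}))"
      using that finite_pending[OF X] by (intro card.remove)
    moreover have "size (unfold G X (Suc t) g) = size (residue G X g)
        + (size (unfold G X t (Proper (head G e)))
          + (\<Sum>d\<in>pending X g - {e}. size (unfold G X t (Proper (head G d)))))"
      unfolding size_unfold_Suc using that finite_pending[OF X, of g] by (simp add: sum.remove)
    ultimately show ?thesis by linarith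
  qed
  define P where "P = (\<lambda>k. \<exists>v. \<not> dies G X (Proper v) \<and> bounded_unfold G X (Proper v) k)"
  have child: "\<exists>e\<in>pending X g. \<not> dies G X (Proper (head G e))" if "\<not> dies G X g" for g
    using that dies.intros by metis
  have "\<exists>k. P k"
  proof -
    obtain e where e: "e \<in> pending X g" "\<not> dies G X (Proper (head G e))"
      using child[OF g(1)] by blast
    moreover obtain k where "bounded_unfold G X g k" using g by blast
    then have "bounded_unfold G X (Proper (head G e)) k"
      using drop[OF e(1)] by (meson add_leD1 le_trans)
    ultimately show ?thesis unfolding P_def by blast
  qed
  \<comment> \<open>The least bound attained by a vertex that does not die. Any residue or second
    edge at a vertex of \<open>W\<close> would give a child with a smaller bound.\<close>
  define k where "k = (LEAST k. P k)"
  have Pk: "P k" unfolding k_def using \<open>\<exists>k. P k\<close> by (rule LeastI_ex)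
  define W where "W = {v. \<not> dies G X (Proper v) \<and> bounded_unfold G X (Proper v) k}"
  have W: "\<exists>e. X v = {e} \<and> out_arcs G v = {e} \<and> head G e \<in> W" if v: "v \<in> W" for v
  proof -
    obtain e where e: "e \<in> X v" "\<not> dies G X (Proper (head G e))"
      using child[of "Proper v"] v by (auto simp: W_def)
    let ?r = "size (residue G X (Proper v)) + card (X v) - 1"
    have bound: "size (unfold G X t (Proper (head G e))) + ?r \<le> k" for t
    proof -
      have "size (unfold G X t (Proper (head G e))) + ?r \<le> size (unfold G X (Suc t) (Proper v))"
        using drop[of e "Proper v" t] e(1) by simp
      also have "\<dots> \<le> k" using v unfolding W_def by blast
      finally show ?thesis .
    qed
    have "P (k - ?r)"
      unfolding P_def using e(2) bound by (metis add_le_imp_le_diff)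
    then have "k \<le> k - ?r" unfolding k_def by (rule Least_le)
    \<comment> \<open>Subtraction on naturals stops at zero, so \<open>k \<le> k - ?r\<close> yields
      \<open>?r = 0\<close> only for positive \<open>k\<close>.\<close>
    moreover have "k \<ge> 1" using bound[of 0] by simp
    ultimately have r: "?r = 0" by linarith
    have fin: "finite (X v)" using X by (simp add: truncation_def)
    then have "card (X v) \<ge> 1" using e by (metis One_nat_def Suc_leI card_gt_0_iff empty_iff)
    with r have "card (X v) = 1" and "size (residue G X (Proper v)) = 0" by linarith+
    \<comment> \<open>An empty residue at an expanded proper vertex forces regularity, and then the
      truncation keeps every edge at \<open>v\<close>, so \<open>e\<close> is its only one.\<close>
    then have "X v = {e}" "regular G v"
      using e by (auto simp: card_1_singleton_iff split: if_splits)
    moreover from this have "out_arcs G v = {e}" using X by (auto simp: truncation_def)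
    moreover have "head G e \<in> W" using e(2) bound unfolding W_def by (blast dest: add_leD1)
    ultimately show ?thesis by blast
  qed
  then obtain f where f: "\<And>v. v \<in> W \<Longrightarrow> X v = {f v} \<and> out_arcs G v = {f v} \<and> head G (f v) \<in> W"
    by metis
  have "W \<subseteq> {v. X v \<noteq> {}}" using f by auto
  then have "finite W" using truncation_finite[OF X] by (rule finite_subset)
  moreover have "W \<noteq> {}" using Pk by (auto simp: P_def W_def)
  ultimately obtain p where p: "cycle p" "set p \<subseteq> f ` W"
    using cycle_in_finite_set[OF assms(1), of W f] f by blast
  have "out_arcs G (tail G e) = {e}" if e: "e \<in> set p" for e
  proof -
    obtain v where v: "v \<in> W" "e = f v" using p e by blast
    then have "out_arcs G v = {e}" using f by blast
    moreover from this have "tail G e = v" by (metis in_out_arcs_conv singletonI)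
    ultimately show ?thesis by simp
  qed
  then have "\<not> has_exit G p" using has_exit_iff[OF p(1)] by blast
  with p that show ?thesis by blast
qed

section \<open>The three equivalences\<close>

theorem corollary5p8:
  fixes G :: "('a, 'b) pre_digraph"
  assumes "wf_digraph G"
  shows "((\<exists>p. pre_digraph.cycle G p \<and> \<not> has_exit G p) \<longleftrightarrow>
            (\<exists>a \<in> free_monoid G. a \<noteq> {#} \<and> periodic G a)) \<and>
         ((\<exists>p. pre_digraph.cycle G p \<and> has_exit G p) \<longleftrightarrow>
            (\<exists>a \<in> free_monoid G. aperiodic G a)) \<and>
         (acyclic_digraph G \<longleftrightarrow>
            (\<forall>a \<in> free_monoid G. a \<noteq> {#} \<longrightarrow> incomparable G a))"
proof (intro conjI iffI)
  assume "\<exists>p. pre_digraph.cycle G p \<and> \<not> has_exit G p"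
  then show "\<exists>a \<in> free_monoid G. a \<noteq> {#} \<and> periodic G a"
    by (metis add.right_neutral assms periodic_def sim_cycle)
next
  assume "\<exists>a \<in> free_monoid G. a \<noteq> {#} \<and> periodic G a"
  then show "\<exists>p. pre_digraph.cycle G p \<and> \<not> has_exit G p"
    by (metis assms periodic_def periodic_imp_cycle_without_exit)
next
  assume "\<exists>p. pre_digraph.cycle G p \<and> has_exit G p"
  then obtain p where p: "pre_digraph.cycle G p" "has_exit G p" by blast
  obtain a c n where a: "a \<in> free_monoid G" "c \<in> free_monoid G" "n > 0" "c \<noteq> {#}"
    "sim G a (act n a + c)"
    using sim_cycle[OF assms p(1)] p(2) by metis
  have "precsim G (act n a) a" using a by (auto simp: precsim_def intro: sim.sym)
  \<comment> \<open>Otherwise \<open>a\<close> would be equivalent to both \<open>act n a\<close>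
    and \<open>act n a + c\<close>, and cancellation would give \<open>c = {#}\<close>.\<close>
  moreover have "\<not> sim G (act n a) a" using a sim_plus_cancel sim.sym by blast
  ultimately show "\<exists>a \<in> free_monoid G. aperiodic G a"
    using a by (auto simp: aperiodic_def succ_def)
next
  assume "\<exists>a \<in> free_monoid G. aperiodic G a"
  then obtain a n c where "n > 0" "sim G (act n a + c) a" "\<not> sim G (act n a) a"
    by (auto simp: aperiodic_def succ_def precsim_def)
  moreover from this have "c \<noteq> {#}" by auto
  ultimately show "\<exists>p. pre_digraph.cycle G p \<and> has_exit G p"
    using aperiodic_imp_cycle_with_exit[OF assms] sim.sym by metis
next
  assume acyc: "acyclic_digraph G"
  show "\<forall>a \<in> free_monoid G. a \<noteq> {#} \<longrightarrow> incomparable G a"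
  proof (intro ballI impI)
    fix a assume a: "a \<in> free_monoid G" "a \<noteq> {#}"
    have np: "\<not> sim G a (act n a)" if "n > 0" for n
      using periodic_imp_cycle_without_exit[OF assms _ that a(2)] acyc
      unfolding acyclic_digraph_def by metis
    have "\<not> precsim G a (act n a)" if "n > 0" for n
    proof
      assume "precsim G a (act n a)"
      then obtain c where "sim G (a + c) (act n a)" by (auto simp: precsim_def)
      \<comment> \<open>Comparability in this direction collapses to periodicity, which would yield
        a cycle.\<close>
      moreover from this have "c = {#}" using sim_act_plus_cancel sim.sym that by blast
      ultimately show False using np[OF that] by simp
    qed
    moreover have "\<not> precsim G (act n a) a" if "n > 0" for n
    proof
      assume "precsim G (act n a) a"
      then obtain c where c: "sim G a (act n a + c)" by (auto simp: precsim_def intro: sim.sym)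
      then have "c \<noteq> {#}" using np[OF that] by auto
      with aperiodic_imp_cycle_with_exit[OF assms c that] acyc show False
        unfolding acyclic_digraph_def by metis
    qed
    ultimately show "incomparable G a" by (simp add: incomparable_def)
  qed
next
  assume inc: "\<forall>a \<in> free_monoid G. a \<noteq> {#} \<longrightarrow> incomparable G a"
  show "acyclic_digraph G"
    unfolding acyclic_digraph_def
  proof
    assume "\<exists>p. pre_digraph.cycle G p"
    then obtain a c n where a: "a \<in> free_monoid G" "a \<noteq> {#}" "c \<in> free_monoid G" "n > 0"
      "sim G a (act n a + c)"
      using sim_cycle[OF assms] by metis
    \<comment> \<open>With or without an exit, going once around a cycle makes its vertex comparable
      to a shift of itself.\<close>
    then have "precsim G (act n a) a" by (auto simp: precsim_def intro: sim.sym)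
    then show False using inc a by (auto simp: incomparable_def)
  qed
qed

end
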